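(* Suppose $A\subseteq 2^\omega$ is a Turing independent set of reals which contains a perfect set $A'$, $B$ is a countable dense subset of $A'$, and $x\in 2^\omega$ computes every element of $B$. Then $(A\setminus B)\cup\{x\}$ is not Turing independent.
   Context: A set $A\subseteq 2^\omega$ is Turing independent if whenever $a_0,\ldots,a_n\in A$ and $b\in A$ is not equal to any $a_i$, then $a_0\oplus\cdots\oplus a_n$ does not compute $b$ (i.e. $b\not\leq_T a_0\oplus\cdots\oplus a_n$). A perfect set is a nonempty closed subset of $2^\omega$ with no isolated points; "dense subset of $A'$" refers to the subspace topology on $A'$. *)

theory Defs
  imports Main "HOL-Library.Countable_Set"
begin

datatype recf =
    Z
  | S
  | Id nat
  | Comp recf "recf list"
  | Pr recf recf
  | Mn recf
  | Orc

inductive oeval :: "(nat \<Rightarrow> bool) \<Rightarrow> recf \<Rightarrow> nat list \<Rightarrow> nat \<Rightarrow> bool" for X where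
  zero: "oeval X Z xs 0"
| succ: "oeval X S (x # xs) (Suc x)"
| proj: "i < length xs \<Longrightarrow> oeval X (Id i) xs (xs ! i)"
| comp: "list_all2 (\<lambda>g y. oeval X g xs y) gs ys \<Longrightarrow> oeval X f ys v \<Longrightarrow> oeval X (Comp f gs) xs v"
| pr0: "oeval X f xs v \<Longrightarrow> oeval X (Pr f g) (0 # xs) v"
| prS: "oeval X (Pr f g) (n # xs) r \<Longrightarrow> oeval X g (r # n # xs) v \<Longrightarrow> oeval X (Pr f g) (Suc n # xs) v"
| mn: "oeval X f (v # xs) 0 \<Longrightarrow> (\<forall>u<v. \<exists>r. oeval X f (u # xs) r \<and> r \<noteq> 0) \<Longrightarrow> oeval X (Mn f) xs v"
| orc: "oeval X Orc (n # xs) (if X n then 1 else 0)"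

definition turing_le :: "(nat \<Rightarrow> bool) \<Rightarrow> (nat \<Rightarrow> bool) \<Rightarrow> bool" where
  "turing_le b X \<longleftrightarrow> (\<exists>p. \<forall>n. oeval X p [n] (if b n then 1 else 0))"

definition join :: "(nat \<Rightarrow> bool) list \<Rightarrow> (nat \<Rightarrow> bool)" where
  "join as = (\<lambda>k. (as ! (k mod length as)) (k div length as))"

definition turing_independent :: "(nat \<Rightarrow> bool) set \<Rightarrow> bool" where
  "turing_independent A \<longleftrightarrow>
     (\<forall>as b. as \<noteq> [] \<and> set as \<subseteq> A \<and> b \<in> A \<and> b \<notin> set as \<longrightarrow> \<not> turing_le b (join as))"

text \<open>Cantor space topology (product topology), via initial segments.\<close>
definition agree_upto :: "nat \<Rightarrow> (nat \<Rightarrow> bool) \<Rightarrow> (nat \<Rightarrow> bool) \<Rightarrow> bool" where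
  "agree_upto n x y \<longleftrightarrow> (\<forall>i<n. x i = y i)"

definition cantor_closed :: "(nat \<Rightarrow> bool) set \<Rightarrow> bool" where
  "cantor_closed C \<longleftrightarrow> (\<forall>x. (\<forall>n. \<exists>y\<in>C. agree_upto n x y) \<longrightarrow> x \<in> C)"

definition perfect_set :: "(nat \<Rightarrow> bool) set \<Rightarrow> bool" where
  "perfect_set C \<longleftrightarrow> C \<noteq> {} \<and> cantor_closed C \<and>
     (\<forall>x\<in>C. \<forall>n. \<exists>y\<in>C. y \<noteq> x \<and> agree_upto n x y)"

definition dense_in :: "(nat \<Rightarrow> bool) set \<Rightarrow> (nat \<Rightarrow> bool) set \<Rightarrow> bool" where
  "dense_in D C \<longleftrightarrow> D \<subseteq> C \<and> (\<forall>x\<in>C. \<forall>n. \<exists>y\<in>D. agree_upto n x y)"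

end

theory Submission
  imports Defs "HOL-Library.Nat_Bijection"
begin

text \<open>A real \<open>y \<in> A' - B\<close> different from \<open>x\<close> is coded into six reals of \<open>A'\<close>, arranged in two
  triples, that together with \<open>x\<close> compute it. In a triple, the reals take turns: at stage \<open>t\<close> one of
  them leaves the element \<open>p t\<close> of \<open>B\<close> it has been following and switches to another element
  \<open>p (t + 3)\<close> of \<open>B\<close>, the first disagreement being at a position \<open>switch p t\<close>. Density allows this
  position to be arbitrarily large, although not to be chosen exactly. We take it so large that it
  bounds an index, relative to \<open>x\<close>, of \<open>p (t + 2)\<close>, and that every wrong index for \<open>p (t + 1)\<close> up to
  \<open>switch p (t - 1)\<close> fails below \<open>switch p t\<close>. Then \<open>switch p (t + 2)\<close> can be computed from
  \<open>switch p t\<close> and \<open>switch p (t + 1)\<close> with a universal machine, so \<open>switch p\<close> is computable from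
  \<open>x\<close> and the triple. The two triples, following \<open>p\<close> and \<open>q\<close>, are built simultaneously such that
  \<open>y t\<close> holds iff \<open>switch p t < switch q t\<close>.\<close>

subsection \<open>Functions computable in an oracle\<close>

text \<open>The list \<^term>\<open>args a\<close> holds the arguments on which a program has to produce \<^term>\<open>f a\<close>;
  functions of any arity are thus treated at once.\<close>

definition computable_on :: "(nat \<Rightarrow> bool) \<Rightarrow> ('a \<Rightarrow> nat list) \<Rightarrow> ('a \<Rightarrow> nat) \<Rightarrow> bool" where
  "computable_on X args f \<longleftrightarrow> (\<exists>p. \<forall>a. oeval X p (args a) (f a))"

abbreviation (input) computable_in :: "(nat \<Rightarrow> bool) \<Rightarrow> (nat \<Rightarrow> nat) \<Rightarrow> bool" where
  "computable_in X f \<equiv> computable_on X (\<lambda>n. [n]) f"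

abbreviation (input) args2 :: "nat \<times> nat \<Rightarrow> nat list" where
  "args2 u \<equiv> [fst u, snd u]"

abbreviation (input) args3 :: "nat \<times> nat \<times> nat \<Rightarrow> nat list" where
  "args3 u \<equiv> [fst u, fst (snd u), snd (snd u)]"

lemma computable_onI: "(\<And>a. oeval X p (args a) (f a)) \<Longrightarrow> computable_on X args f"
  unfolding computable_on_def by blast

lemma computable_argument:
  assumes "\<And>a. i < length (args a) \<and> args a ! i = f a"
  shows "computable_on X args f"
  by (rule computable_onI[where p = "Id i"]) (metis assms oeval.proj)

lemma computable_id: "computable_in X (\<lambda>n. n)"
  by (rule computable_argument[of 0]) simp

lemma computable_args2:
  "computable_on X args2 (\<lambda>u. fst u)"
  "computable_on X args2 (\<lambda>u. snd u)"
  by (rule computable_argument[of 0], simp, rule computable_argument[of 1], simp)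

lemma computable_args3:
  "computable_on X args3 (\<lambda>u. fst u)"
  "computable_on X args3 (\<lambda>u. fst (snd u))"
  "computable_on X args3 (\<lambda>u. snd (snd u))"
  by (rule computable_argument[of 0], simp, rule computable_argument[of 1], simp,
      rule computable_argument[of 2], simp)

lemma computable_compose_list:
  assumes "computable_on X args' h" and "\<And>f. f \<in> set fs \<Longrightarrow> computable_on X args f"
    and args': "\<And>a. args' (\<phi> a) = map (\<lambda>f. f a) fs"
  shows "computable_on X args (\<lambda>a. h (\<phi> a))"
proof -
  obtain p where p: "\<And>b. oeval X p (args' b) (h b)"
    using assms(1) unfolding computable_on_def by blast
  obtain prog where prog: "\<And>f a. f \<in> set fs \<Longrightarrow> oeval X (prog f) (args a) (f a)"
    using assms(2) unfolding computable_on_def by metis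
  show ?thesis
  proof (rule computable_onI[where p = "Comp p (map prog fs)"], rule oeval.comp)
    fix a
    show "list_all2 (\<lambda>g y. oeval X g (args a) y) (map prog fs) (args' (\<phi> a))"
      using prog by (simp add: args' list_all2_map1 list_all2_map2 list_all2_same)
    show "oeval X p (args' (\<phi> a)) (h (\<phi> a))"
      by (rule p)
  qed
qed

lemma computable_compose:
  "computable_in X g \<Longrightarrow> computable_on X args f \<Longrightarrow> computable_on X args (\<lambda>a. g (f a))"
  using computable_compose_list[of X "\<lambda>n. [n]" g "[f]" args f] by simp

lemma computable_compose2:
  assumes "computable_on X args2 (\<lambda>u. h (fst u) (snd u))"
    and "computable_on X args f" "computable_on X args g"
  shows "computable_on X args (\<lambda>a. h (f a) (g a))"
  using computable_compose_list[OF assms(1), of "[f, g]" args "\<lambda>a. (f a, g a)"] assms(2,3) by auto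

lemma computable_Suc:
  assumes "computable_on X args f"
  shows "computable_on X args (\<lambda>a. Suc (f a))"
proof -
  have "computable_in X Suc" by (rule computable_onI) (rule oeval.succ)
  then show ?thesis using assms by (rule computable_compose)
qed

lemma computable_const: "computable_on X args (\<lambda>a. c)"
proof (induction c)
  case 0
  show ?case by (rule computable_onI[where p = Z]) (rule oeval.zero)
next
  case (Suc c)
  then show ?case by (rule computable_Suc)
qed

lemma computable_rec_nat_argument:
  assumes "computable_on X args f"
    and "computable_on X (\<lambda>u. fst u # fst (snd u) # args (snd (snd u)))
           (\<lambda>u. g (snd (snd u)) (fst (snd u)) (fst u))"
  shows "computable_on X (\<lambda>u. fst u # args (snd u)) (\<lambda>u. rec_nat (f (snd u)) (g (snd u)) (fst u))"
proof -
  obtain p where p: "\<And>a. oeval X p (args a) (f a)"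
    using assms(1) unfolding computable_on_def by blast
  obtain q where "\<And>u. oeval X q (fst u # fst (snd u) # args (snd (snd u)))
      (g (snd (snd u)) (fst (snd u)) (fst u))"
    using assms(2) unfolding computable_on_def by blast
  from this[of "(r, i, a)" for r i a]
  have q: "\<And>r i a. oeval X q (r # i # args a) (g a i r)" by simp
  have "oeval X (Pr p q) (n # args a) (rec_nat (f a) (g a) n)" for n a
  proof (induction n)
    case 0
    show ?case using p by (simp add: oeval.pr0)
  next
    case (Suc n)
    show ?case using oeval.prS[OF Suc q] by simp
  qed
  then show ?thesis by (intro computable_onI)
qed

lemma computable_rec_nat_param:
  assumes "computable_in X f" "computable_on X args3 (\<lambda>u. g (snd (snd u)) (fst (snd u)) (fst u))"
    and "computable_on X args h" "computable_on X args k"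
  shows "computable_on X args (\<lambda>a. rec_nat (f (k a)) (g (k a)) (h a))"
  using computable_compose2[OF computable_rec_nat_argument[OF assms(1,2)] assms(3,4)] .

lemma computable_add:
  assumes "computable_on X args f" "computable_on X args g"
  shows "computable_on X args (\<lambda>a. f a + g a)"
proof -
  have "rec_nat m (\<lambda>i. Suc) n = n + m" for m n :: nat by (induction n) auto
  moreover have "computable_on X args (\<lambda>a. rec_nat (g a) (\<lambda>i. Suc) (f a))"
    by (intro computable_rec_nat_param computable_id computable_Suc computable_args3 assms)
  ultimately show ?thesis by simp
qed

lemma computable_mult:
  assumes "computable_on X args f" "computable_on X args g"
  shows "computable_on X args (\<lambda>a. f a * g a)"
proof -
  have "rec_nat 0 (\<lambda>i r. r + m) n = n * m" for m n :: nat by (induction n) auto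
  moreover have "computable_on X args (\<lambda>a. rec_nat 0 (\<lambda>i r. r + g a) (f a))"
    by (intro computable_rec_nat_param[where f = "\<lambda>_. 0" and g = "\<lambda>m i r. r + m"]
        computable_const computable_add computable_args3 assms)
  ultimately show ?thesis by simp
qed

lemma computable_pred:
  assumes "computable_on X args f"
  shows "computable_on X args (\<lambda>a. f a - 1)"
proof -
  have "rec_nat 0 (\<lambda>i r. i) n = n - 1" for n :: nat by (cases n) auto
  moreover have "computable_on X args (\<lambda>a. rec_nat 0 (\<lambda>i r. i) (f a))"
    by (rule computable_rec_nat_param[where f = "\<lambda>_. 0" and g = "\<lambda>_ i r. i", OF
        computable_const computable_args3(2) assms assms])
  ultimately show ?thesis by simp
qed

lemma computable_diff:
  assumes "computable_on X args f" "computable_on X args g"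
  shows "computable_on X args (\<lambda>a. f a - g a)"
proof -
  have "rec_nat m (\<lambda>i r. r - 1) n = m - n" for m n :: nat by (induction n) auto
  moreover have "computable_on X args (\<lambda>a. rec_nat (f a) (\<lambda>i r. r - 1) (g a))"
    by (intro computable_rec_nat_param computable_id computable_pred computable_args3 assms)
  ultimately show ?thesis by simp
qed

lemma computable_Least_zero:
  assumes "computable_on X (\<lambda>u. fst u # args (snd u)) (\<lambda>u. g (snd u) (fst u))"
    and zero: "\<And>a. \<exists>i. g a i = 0"
  shows "computable_on X args (\<lambda>a. LEAST i. g a i = 0)"
proof -
  obtain p where "\<And>u. oeval X p (fst u # args (snd u)) (g (snd u) (fst u))"
    using assms(1) unfolding computable_on_def by blast
  from this[of "(i, a)" for i a] have p: "\<And>i a. oeval X p (i # args a) (g a i)" by simp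
  show ?thesis
  proof (rule computable_onI[where p = "Mn p"], rule oeval.mn)
    fix a
    have "g a (LEAST i. g a i = 0) = 0" using LeastI_ex[OF zero] .
    then show "oeval X p ((LEAST i. g a i = 0) # args a) 0" using p by metis
    show "\<forall>u<LEAST i. g a i = 0. \<exists>r. oeval X p (u # args a) r \<and> r \<noteq> 0"
      using p not_less_Least by blast
  qed
qed

subsection \<open>Pairing\<close>

abbreviation (input) pair :: "nat \<Rightarrow> nat \<Rightarrow> nat" where
  "pair a b \<equiv> prod_encode (a, b)"

abbreviation (input) pfst :: "nat \<Rightarrow> nat" where
  "pfst n \<equiv> fst (prod_decode n)"

abbreviation (input) psnd :: "nat \<Rightarrow> nat" where
  "psnd n \<equiv> snd (prod_decode n)"

lemma computable_triangle:
  assumes "computable_on X args f"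
  shows "computable_on X args (\<lambda>a. triangle (f a))"
proof -
  have "rec_nat 0 (\<lambda>i r. r + Suc i) n = triangle n" for n :: nat by (induction n) auto
  moreover have "computable_on X args (\<lambda>a. rec_nat 0 (\<lambda>i r. r + Suc i) (f a))"
    by (rule computable_rec_nat_param[where f = "\<lambda>_. 0" and g = "\<lambda>_ i r. r + Suc i", OF
        computable_const _ assms assms])
      (intro computable_add computable_Suc computable_args3)
  ultimately show ?thesis by simp
qed

lemma computable_pair:
  assumes "computable_on X args f" "computable_on X args g"
  shows "computable_on X args (\<lambda>a. pair (f a) (g a))"
  unfolding prod_encode_def prod.case
  by (intro computable_add computable_triangle assms)

lemma triangle_mono: "a \<le> b \<Longrightarrow> triangle a \<le> triangle b"
  unfolding triangle_def by (intro div_le_mono mult_le_mono) auto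

lemma le_triangle: "n \<le> triangle n"
  by (induction n) auto

definition triangle_root :: "nat \<Rightarrow> nat" where
  "triangle_root n = (LEAST i. Suc n - triangle (Suc i) = 0)"

lemma triangle_root_pair: "triangle_root (pair a b) = a + b"
  unfolding triangle_root_def
proof (rule Least_equality)
  show "Suc (pair a b) - triangle (Suc (a + b)) = 0"
    by (simp add: prod_encode_def)
next
  fix i assume i: "Suc (pair a b) - triangle (Suc i) = 0"
  show "a + b \<le> i"
  proof (rule ccontr)
    assume "\<not> a + b \<le> i"
    then have "triangle (Suc i) \<le> triangle (a + b)" by (intro triangle_mono) simp
    then show False using i by (simp add: prod_encode_def)
  qed
qed

lemma
  shows pfst_triangle_root: "pfst n = n - triangle (triangle_root n)"
    and psnd_triangle_root: "psnd n = triangle_root n - pfst n"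
proof -
  obtain a b where "n = pair a b" by (metis prod_decode_inverse prod.collapse)
  then show "pfst n = n - triangle (triangle_root n)" "psnd n = triangle_root n - pfst n"
    by (simp_all add: triangle_root_pair) (simp add: prod_encode_def)
qed

lemma computable_triangle_root: "computable_in X triangle_root"
  unfolding triangle_root_def[abs_def]
proof (rule computable_Least_zero)
  show "computable_on X args2 (\<lambda>u. Suc (snd u) - triangle (Suc (fst u)))"
    by (intro computable_diff computable_triangle computable_Suc computable_args2)
  show "\<exists>i. Suc n - triangle (Suc i) = 0" for n
    using le_triangle[of "Suc n"] by (metis diff_is_0_eq)
qed

lemma computable_pfst: "computable_on X args f \<Longrightarrow> computable_on X args (\<lambda>a. pfst (f a))"
  unfolding pfst_triangle_root
  by (intro computable_diff computable_triangle computable_compose[OF computable_triangle_root])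

lemma computable_psnd: "computable_on X args f \<Longrightarrow> computable_on X args (\<lambda>a. psnd (f a))"
  unfolding psnd_triangle_root
  by (intro computable_diff computable_pfst computable_compose[OF computable_triangle_root])

text \<open>A function or predicate of several arguments is presented below as one of a single code,
  which \<^term>\<open>pfst\<close> and \<^term>\<open>psnd\<close> take apart.\<close>

lemma computable_rec_nat:
  assumes "computable_in X f" "computable_in X (\<lambda>m. g (pfst (pfst m)) (psnd (pfst m)) (psnd m))"
    and "computable_in X h"
  shows "computable_in X (\<lambda>n. rec_nat (f n) (g n) (h n))"
proof -
  have "computable_on X args3 (\<lambda>u. pair (pair (snd (snd u)) (fst (snd u))) (fst u))"
    by (intro computable_pair computable_args3)
  from computable_compose[OF assms(2) this]
  have "computable_on X args3 (\<lambda>u. g (snd (snd u)) (fst (snd u)) (fst u))" by simp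
  then show ?thesis
    by (rule computable_rec_nat_param[OF assms(1) _ assms(3) computable_id])
qed

lemma computable_funpow:
  assumes "computable_in X (\<lambda>m. g (psnd m))" "computable_in X h" "computable_in X f"
  shows "computable_in X (\<lambda>n. (g ^^ h n) (f n))"
proof -
  have "(g ^^ k) s = rec_nat s (\<lambda>_. g) k" for k s by (induction k) auto
  moreover have "computable_in X (\<lambda>n. rec_nat (f n) (\<lambda>_. g) (h n))"
    by (rule computable_rec_nat[OF assms(3,1,2)])
  ultimately show ?thesis by simp
qed

definition entry :: "nat \<Rightarrow> nat \<Rightarrow> nat" where
  "entry h i = pfst ((psnd ^^ i) h)"

lemma ex_entry: "\<exists>h. \<forall>i<n. entry h i = f i"
proof (induction n arbitrary: f)
  case 0
  show ?case by simp
next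
  case (Suc n)
  obtain h where h: "\<And>i. i < n \<Longrightarrow> entry h i = f (Suc i)"
    using Suc.IH[of "\<lambda>i. f (Suc i)"] by blast
  have "entry (pair (f 0) h) i = f i" if "i < Suc n" for i
    using that h by (cases i) (simp_all add: entry_def funpow_Suc_right del: funpow.simps(2))
  then show ?case by blast
qed

lemma computable_entry:
  assumes "computable_in X f" "computable_in X g"
  shows "computable_in X (\<lambda>n. entry (f n) (g n))"
  unfolding entry_def
  by (intro computable_pfst computable_funpow computable_psnd computable_id assms)

subsection \<open>Decidable and semidecidable predicates\<close>

abbreviation (input) decidable_in :: "(nat \<Rightarrow> bool) \<Rightarrow> (nat \<Rightarrow> bool) \<Rightarrow> bool" where
  "decidable_in X P \<equiv> turing_le P X"

lemma decidable_iff_computable: "decidable_in X P \<longleftrightarrow> computable_in X (\<lambda>n. of_bool (P n))"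
  by (simp add: turing_le_def computable_on_def of_bool_def)

lemma decidable_oracle: "decidable_in X X"
  unfolding turing_le_def by (blast intro: oeval.orc)

lemma decidable_compose: "decidable_in X P \<Longrightarrow> computable_in X f \<Longrightarrow> decidable_in X (\<lambda>n. P (f n))"
  unfolding decidable_iff_computable by (rule computable_compose)

lemma computable_of_bool: "decidable_in X P \<Longrightarrow> computable_in X (\<lambda>n. of_bool (P n))"
  by (simp add: decidable_iff_computable)

lemma decidable_not:
  assumes "decidable_in X P"
  shows "decidable_in X (\<lambda>n. \<not> P n)"
proof -
  have "computable_in X (\<lambda>n. 1 - of_bool (P n))"
    by (intro computable_diff computable_const computable_of_bool assms)
  moreover have "1 - of_bool (P n) = (of_bool (\<not> P n) :: nat)" for n by simp
  ultimately show ?thesis by (simp only: decidable_iff_computable)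
qed

lemma decidable_conj:
  assumes "decidable_in X P" "decidable_in X Q"
  shows "decidable_in X (\<lambda>n. P n \<and> Q n)"
proof -
  have "computable_in X (\<lambda>n. of_bool (P n) * of_bool (Q n))"
    by (intro computable_mult computable_of_bool assms)
  then show ?thesis unfolding decidable_iff_computable of_bool_conj .
qed

lemma decidable_disj:
  assumes "decidable_in X P" "decidable_in X Q"
  shows "decidable_in X (\<lambda>n. P n \<or> Q n)"
  using decidable_not[OF decidable_conj[OF decidable_not[OF assms(1)] decidable_not[OF assms(2)]]]
  by simp

lemma decidable_le:
  assumes "computable_in X f" "computable_in X g"
  shows "decidable_in X (\<lambda>n. f n \<le> g n)"
proof -
  have "computable_in X (\<lambda>n. 1 - (f n - g n))"
    by (intro computable_diff computable_const assms)
  moreover have "1 - (f n - g n) = of_bool (f n \<le> g n)" for n by auto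
  ultimately show ?thesis by (simp only: decidable_iff_computable)
qed

lemma decidable_less:
  "computable_in X f \<Longrightarrow> computable_in X g \<Longrightarrow> decidable_in X (\<lambda>n. f n < g n)"
  using decidable_not[OF decidable_le[of X g f]] by (simp only: not_le)

lemma decidable_eq:
  "computable_in X f \<Longrightarrow> computable_in X g \<Longrightarrow> decidable_in X (\<lambda>n. f n = g n)"
  using decidable_conj[OF decidable_le[of X f g] decidable_le[of X g f]]
  by (simp only: order_eq_iff)

lemma computable_if:
  assumes "decidable_in X P" "computable_in X f" "computable_in X g"
  shows "computable_in X (\<lambda>n. if P n then f n else g n)"
proof -
  have "computable_in X (\<lambda>n. of_bool (P n) * f n + of_bool (\<not> P n) * g n)"
    by (intro computable_add computable_mult computable_of_bool decidable_not assms)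
  moreover have "of_bool (P n) * f n + of_bool (\<not> P n) * g n = (if P n then f n else g n)" for n
    by simp
  ultimately show ?thesis by simp
qed

lemma decidable_bex:
  assumes "decidable_in X (\<lambda>m. P (pfst m) (psnd m))" "computable_in X f"
  shows "decidable_in X (\<lambda>n. \<exists>i<f n. P n i)"
proof -
  have eq: "rec_nat 0 (\<lambda>i r. if P n i then 1 else r) k = of_bool (\<exists>i<k. P n i)" for n k
    by (induction k) (auto simp: less_Suc_eq)
  have "decidable_in X (\<lambda>m. P (pfst (pfst m)) (psnd (pfst m)))"
    using decidable_compose[OF assms(1) computable_pfst[OF computable_id]] .
  then have "computable_in X (\<lambda>n. rec_nat 0 (\<lambda>i r. if P n i then 1 else r) (f n))"
    by (intro computable_rec_nat computable_const computable_if computable_psnd computable_id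
        assms(2))
  then show ?thesis by (simp only: eq decidable_iff_computable)
qed

lemma decidable_ball:
  assumes "decidable_in X (\<lambda>m. P (pfst m) (psnd m))" "computable_in X f"
  shows "decidable_in X (\<lambda>n. \<forall>i<f n. P n i)"
proof -
  have "decidable_in X (\<lambda>n. \<not> (\<exists>i<f n. \<not> P n i))" by (intro decidable_not decidable_bex assms)
  then show ?thesis by simp
qed

lemma computable_Least:
  assumes "decidable_in X (\<lambda>m. P (pfst m) (psnd m))" "\<And>n. \<exists>i. P n i"
  shows "computable_in X (\<lambda>n. LEAST i. P n i)"
proof -
  have "computable_on X args2 (\<lambda>u. pair (snd u) (fst u))"
    by (intro computable_pair computable_args2)
  from computable_compose[OF computable_of_bool[OF decidable_not[OF assms(1)]] this]
  have "computable_on X args2 (\<lambda>u. of_bool (\<not> P (snd u) (fst u)))" by simp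
  then have "computable_in X (\<lambda>n. LEAST i. of_bool (\<not> P n i) = (0 :: nat))"
    by (rule computable_Least_zero) (use assms(2) in simp)
  then show ?thesis by simp
qed

definition semidecidable_in :: "(nat \<Rightarrow> bool) \<Rightarrow> (nat \<Rightarrow> bool) \<Rightarrow> bool" where
  "semidecidable_in X P \<longleftrightarrow> (\<exists>R. decidable_in X R \<and> (\<forall>n. P n \<longleftrightarrow> (\<exists>w. R (pair n w))))"

lemma semidecidableI:
  "decidable_in X (\<lambda>m. R (pfst m) (psnd m)) \<Longrightarrow> (\<And>n. P n \<longleftrightarrow> (\<exists>w. R n w)) \<Longrightarrow>
    semidecidable_in X P"
  unfolding semidecidable_in_def by (rule exI[of _ "\<lambda>m. R (pfst m) (psnd m)"]) simp

lemma semidecidableE: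
  assumes "semidecidable_in X P"
  obtains R where "decidable_in X R" "\<And>n. P n \<longleftrightarrow> (\<exists>w. R (pair n w))"
  using assms unfolding semidecidable_in_def by blast

lemma decidable_imp_semidecidable:
  assumes "decidable_in X P"
  shows "semidecidable_in X P"
proof (rule semidecidableI[where R = "\<lambda>n w. P n"])
  show "decidable_in X (\<lambda>m. P (pfst m))"
    by (rule decidable_compose[OF assms computable_pfst[OF computable_id]])
qed simp

lemma semidecidable_compose:
  assumes "semidecidable_in X P" "computable_in X f"
  shows "semidecidable_in X (\<lambda>n. P (f n))"
proof -
  obtain R where R: "decidable_in X R" "\<And>n. P n \<longleftrightarrow> (\<exists>w. R (pair n w))"
    using assms(1) by (elim semidecidableE that)
  show ?thesis
  proof (rule semidecidableI[where R = "\<lambda>n w. R (pair (f n) w)"])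
    show "decidable_in X (\<lambda>m. R (pair (f (pfst m)) (psnd m)))"
      by (intro decidable_compose[OF R(1)] computable_pair computable_compose[OF assms(2)]
          computable_pfst computable_psnd computable_id)
  qed (simp add: R(2))
qed

lemma semidecidable_conj:
  assumes "semidecidable_in X P" "semidecidable_in X Q"
  shows "semidecidable_in X (\<lambda>n. P n \<and> Q n)"
proof -
  obtain R where R: "decidable_in X R" "\<And>n. P n \<longleftrightarrow> (\<exists>w. R (pair n w))"
    using assms(1) by (elim semidecidableE that)
  obtain T where T: "decidable_in X T" "\<And>n. Q n \<longleftrightarrow> (\<exists>w. T (pair n w))"
    using assms(2) by (elim semidecidableE that)
  show ?thesis
  proof (rule semidecidableI[where R = "\<lambda>n w. R (pair n (pfst w)) \<and> T (pair n (psnd w))"])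
    show "decidable_in X
        (\<lambda>m. R (pair (pfst m) (pfst (psnd m))) \<and> T (pair (pfst m) (psnd (psnd m))))"
      by (intro decidable_conj decidable_compose[OF R(1)] decidable_compose[OF T(1)] computable_pair
          computable_pfst computable_psnd computable_id)
    show "P n \<and> Q n \<longleftrightarrow> (\<exists>w. R (pair n (pfst w)) \<and> T (pair n (psnd w)))" for n
      unfolding R(2) T(2) by (metis prod_encode_inverse fst_conv snd_conv)
  qed
qed

lemma semidecidable_disj:
  assumes "semidecidable_in X P" "semidecidable_in X Q"
  shows "semidecidable_in X (\<lambda>n. P n \<or> Q n)"
proof -
  obtain R where R: "decidable_in X R" "\<And>n. P n \<longleftrightarrow> (\<exists>w. R (pair n w))"
    using assms(1) by (elim semidecidableE that)
  obtain T where T: "decidable_in X T" "\<And>n. Q n \<longleftrightarrow> (\<exists>w. T (pair n w))"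
    using assms(2) by (elim semidecidableE that)
  have "decidable_in X (\<lambda>m. R m \<or> T m)" using R(1) T(1) by (rule decidable_disj)
  then show ?thesis
    unfolding semidecidable_in_def R(2) T(2) by blast
qed

lemma semidecidable_ex:
  assumes "semidecidable_in X (\<lambda>m. P (pfst m) (psnd m))"
  shows "semidecidable_in X (\<lambda>n. \<exists>i. P n i)"
proof -
  obtain R where R: "decidable_in X R" "\<And>m. P (pfst m) (psnd m) \<longleftrightarrow> (\<exists>w. R (pair m w))"
    using assms by (elim semidecidableE that)
  have P: "P n i \<longleftrightarrow> (\<exists>w. R (pair (pair n i) w))" for n i
    using R(2)[of "pair n i"] by simp
  show ?thesis
  proof (rule semidecidableI[where R = "\<lambda>n w. R (pair (pair n (pfst w)) (psnd w))"])
    show "decidable_in X (\<lambda>m. R (pair (pair (pfst m) (pfst (psnd m))) (psnd (psnd m))))"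
      by (intro decidable_compose[OF R(1)] computable_pair computable_pfst computable_psnd
          computable_id)
    show "(\<exists>i. P n i) \<longleftrightarrow> (\<exists>w. R (pair (pair n (pfst w)) (psnd w)))" for n
      unfolding P by (metis prod_encode_inverse fst_conv snd_conv)
  qed
qed

lemma semidecidable_ball:
  assumes "semidecidable_in X (\<lambda>m. P (pfst m) (psnd m))" "computable_in X f"
  shows "semidecidable_in X (\<lambda>n. \<forall>i<f n. P n i)"
proof -
  obtain R where R: "decidable_in X R" "\<And>m. P (pfst m) (psnd m) \<longleftrightarrow> (\<exists>w. R (pair m w))"
    using assms(1) by (elim semidecidableE that)
  have P: "P n i \<longleftrightarrow> (\<exists>w. R (pair (pair n i) w))" for n i
    using R(2)[of "pair n i"] by simp
  show ?thesis
  proof (rule semidecidableI[where R = "\<lambda>n W. \<forall>i<f n. \<exists>w<W. R (pair (pair n i) w)"])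
    show "decidable_in X (\<lambda>m. \<forall>i<f (pfst m). \<exists>w<psnd m. R (pair (pair (pfst m) i) w))"
      by (intro decidable_ball decidable_bex decidable_compose[OF R(1)] computable_pair
          computable_compose[OF assms(2)] computable_pfst computable_psnd computable_id)
    show "(\<forall>i<f n. P n i) \<longleftrightarrow> (\<exists>W. \<forall>i<f n. \<exists>w<W. R (pair (pair n i) w))" for n
    proof
      assume "\<forall>i<f n. P n i"
      then obtain w where w: "\<And>i. i < f n \<Longrightarrow> R (pair (pair n i) (w i))" unfolding P by metis
      have "w i < Suc (\<Sum>j<f n. w j)" if "i < f n" for i
        using member_le_sum[of i "{..<f n}" w] that by (simp add: le_imp_less_Suc)
      then show "\<exists>W. \<forall>i<f n. \<exists>v<W. R (pair (pair n i) v)" using w by blast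
    next
      assume "\<exists>W. \<forall>i<f n. \<exists>v<W. R (pair (pair n i) v)"
      then show "\<forall>i<f n. P n i" unfolding P by blast
    qed
  qed
qed

lemma computable_if_semidecidable_graph:
  assumes "semidecidable_in X (\<lambda>m. f (pfst m) = psnd m)"
  shows "computable_in X f"
proof -
  obtain R where R: "decidable_in X R" "\<And>m. f (pfst m) = psnd m \<longleftrightarrow> (\<exists>w. R (pair m w))"
    using assms by (elim semidecidableE that)
  have graph: "f n = v \<longleftrightarrow> (\<exists>w. R (pair (pair n v) w))" for n v
    using R(2)[of "pair n v"] by simp
  define search where "search n = (LEAST s. R (pair (pair n (pfst s)) (psnd s)))" for n
  have ex: "\<exists>s. R (pair (pair n (pfst s)) (psnd s))" for n
    using graph[of n "f n"] by (metis prod_encode_inverse fst_conv snd_conv)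
  have f_eq: "f n = pfst (search n)" for n
    using LeastI_ex[OF ex[of n]] unfolding graph search_def by blast
  show ?thesis
    unfolding f_eq[abs_def] search_def
    by (intro computable_pfst computable_Least decidable_compose[OF R(1)] computable_pair
        computable_psnd computable_id ex)
qed

lemma computable_div:
  assumes "computable_in X f"
  shows "computable_in X (\<lambda>n. f n div c)"
proof (cases "c = 0")
  case True
  then show ?thesis by (simp add: computable_const)
next
  case False
  have "f n div c = q \<longleftrightarrow> c * q \<le> f n \<and> f n < c * Suc q" for n q
    using False div_nat_eqI[of c q "f n"] dividend_less_times_div[of c "f n"] by auto
  moreover have "semidecidable_in X
      (\<lambda>m. c * psnd m \<le> f (pfst m) \<and> f (pfst m) < c * Suc (psnd m))"
    by (intro decidable_imp_semidecidable decidable_conj decidable_le decidable_less computable_mult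
        computable_Suc computable_compose[OF assms] computable_const computable_pfst computable_psnd
        computable_id)
  ultimately show ?thesis by (intro computable_if_semidecidable_graph) simp
qed

lemma computable_mod: "computable_in X f \<Longrightarrow> computable_in X (\<lambda>n. f n mod c)"
  unfolding minus_mult_div_eq_mod[symmetric]
  by (intro computable_diff computable_mult computable_div computable_const)

lemma computable_course_of_values:
  assumes G: "semidecidable_in X (\<lambda>m. G (pfst (pfst m)) (psnd (pfst m)) (psnd m))"
    and G_iff: "\<And>t h z. (\<And>s. s < t \<Longrightarrow> entry h s = d s) \<Longrightarrow> G t h z \<longleftrightarrow> z = d t"
  shows "computable_in X d"
proof (rule computable_if_semidecidable_graph)
  have "d t = v \<longleftrightarrow> (\<exists>h. (\<forall>s<Suc t. G s h (entry h s)) \<and> entry h t = v)" for t v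
  proof
    assume "d t = v"
    obtain h where "\<And>s. s < Suc t \<Longrightarrow> entry h s = d s"
      using ex_entry[of "Suc t" d] by blast
    then show "\<exists>h. (\<forall>s<Suc t. G s h (entry h s)) \<and> entry h t = v"
      using G_iff \<open>d t = v\<close> by (intro exI[of _ h]) auto
  next
    assume "\<exists>h. (\<forall>s<Suc t. G s h (entry h s)) \<and> entry h t = v"
    then obtain h where h: "\<And>s. s < Suc t \<Longrightarrow> G s h (entry h s)" and v: "entry h t = v"
      by blast
    have "s < Suc t \<Longrightarrow> entry h s = d s" for s
    proof (induction s rule: less_induct)
      case (less s)
      then show ?case using G_iff[of s h] h[of s] by simp
    qed
    then show "d t = v" using v by simp
  qed
  moreover have "semidecidable_in X
      (\<lambda>m. \<exists>h. (\<forall>s<Suc (pfst m). G s h (entry h s)) \<and> entry h (pfst m) = psnd m)"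
  proof -
    have "computable_in X
        (\<lambda>k. pair (pair (psnd k) (psnd (pfst k))) (entry (psnd (pfst k)) (psnd k)))"
      by (intro computable_pair computable_entry computable_pfst computable_psnd computable_id)
    from semidecidable_compose[OF G this]
    have "semidecidable_in X (\<lambda>k. G (psnd k) (psnd (pfst k)) (entry (psnd (pfst k)) (psnd k)))"
      by simp
    then show ?thesis
      by (intro semidecidable_ex semidecidable_conj semidecidable_ball
          decidable_imp_semidecidable[OF decidable_eq] computable_entry computable_Suc
          computable_pfst computable_psnd computable_id)
  qed
  ultimately show "semidecidable_in X (\<lambda>m. d (pfst m) = psnd m)" by (simp only:)
qed

lemma join_index:
  assumes "i < length as"
  shows "join as (length as * k + i) = (as ! i) k"
proof -
  have "length as \<noteq> 0" using assms by linarith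
  then have "(length as * k + i) div length as = k" using assms by (subst div_mult_self4) simp_all
  then show ?thesis using assms by (simp add: join_def)
qed

lemma turing_le_join:
  assumes "a \<in> set as"
  shows "turing_le a (join as)"
proof -
  obtain i where "i < length as" "as ! i = a" using assms by (auto simp: in_set_conv_nth)
  then have "join as (length as * n + i) = a n" for n by (simp add: join_index)
  moreover have "turing_le (\<lambda>n. join as (length as * n + i)) (join as)"
    by (intro decidable_compose[OF decidable_oracle] computable_add computable_mult
        computable_const computable_id)
  ultimately show ?thesis by simp
qed

lemma decidable_nth:
  assumes "\<forall>a\<in>set as. turing_le a X" "computable_in X f" "computable_in X g"
  shows "decidable_in X (\<lambda>n. f n < length as \<and> (as ! f n) (g n))"
  using assms
proof (induction as arbitrary: f)
  case Nil
  have "decidable_in X (\<lambda>n. (0 :: nat) < 0)" by (intro decidable_less computable_const)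
  then show ?case by simp
next
  case (Cons a as)
  have "f n < length (a # as) \<and> ((a # as) ! f n) (g n) \<longleftrightarrow>
      f n = 0 \<and> a (g n) \<or> 0 < f n \<and> f n - 1 < length as \<and> (as ! (f n - 1)) (g n)" for n
    by (cases "f n") auto
  moreover have "decidable_in X (\<lambda>n. f n = 0 \<and> a (g n) \<or>
      0 < f n \<and> f n - 1 < length as \<and> (as ! (f n - 1)) (g n))"
  proof -
    have head: "decidable_in X (\<lambda>n. a (g n))"
      using Cons.prems by (simp add: decidable_compose)
    have tail: "decidable_in X (\<lambda>n. f n - 1 < length as \<and> (as ! (f n - 1)) (g n))"
      using Cons.prems by (intro Cons.IH computable_pred) simp_all
    show ?thesis
      by (intro decidable_disj decidable_conj[OF _ head] decidable_conj[OF _ tail] decidable_eq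
          decidable_less computable_const Cons.prems(2))
  qed
  ultimately show ?case by (simp only:)
qed

lemma join_turing_le:
  assumes "as \<noteq> []" "\<forall>a\<in>set as. turing_le a X"
  shows "turing_le (join as) X"
proof -
  have "decidable_in X
      (\<lambda>k. k mod length as < length as \<and> (as ! (k mod length as)) (k div length as))"
    by (intro decidable_nth assms(2) computable_mod computable_div computable_id)
  moreover have "k mod length as < length as" for k using assms(1) by simp
  ultimately show ?thesis by (simp add: join_def)
qed

subsection \<open>A universal machine\<close>

abbreviation (input) cons :: "nat \<Rightarrow> nat \<Rightarrow> nat" where
  "cons a l \<equiv> Suc (pair a l)"

abbreviation (input) hd_code :: "nat \<Rightarrow> nat" where
  "hd_code l \<equiv> pfst (l - 1)"

abbreviation (input) tl_code :: "nat \<Rightarrow> nat" where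
  "tl_code l \<equiv> psnd (l - 1)"

fun code :: "recf \<Rightarrow> nat" where
  "code Z = pair 0 0"
| "code S = pair 1 0"
| "code (Id i) = pair 2 i"
| "code (Comp f gs) = pair 3 (pair (code f) (list_encode (map code gs)))"
| "code (Pr f g) = pair 4 (pair (code f) (code g))"
| "code (Mn f) = pair 5 (code f)"
| "code Orc = pair 6 0"

text \<open>The frames on the stack \<^term>\<open>K\<close> of a configuration record what remains to be done with a
  returned value. Since the machine is deterministic and stops at a value returned to the empty
  stack, it need not be shown sound: a program has at most one result anyway.\<close>

definition conf :: "nat \<Rightarrow> nat \<Rightarrow> nat \<Rightarrow> nat \<Rightarrow> nat" where
  "conf t a b K = pair t (pair a (pair b K))"

abbreviation (input) run :: "nat \<Rightarrow> nat \<Rightarrow> nat \<Rightarrow> nat" where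
  "run e l K \<equiv> conf 0 e l K"

abbreviation (input) run_list :: "nat \<Rightarrow> nat \<Rightarrow> nat \<Rightarrow> nat" where
  "run_list es l K \<equiv> conf 1 es l K"

abbreviation (input) search :: "nat \<Rightarrow> nat \<Rightarrow> nat \<Rightarrow> nat \<Rightarrow> nat" where
  "search e u l K \<equiv> conf 2 (pair e u) l K"

abbreviation (input) ret :: "nat \<Rightarrow> nat \<Rightarrow> nat" where
  "ret v K \<equiv> conf 3 v 0 K"

abbreviation (input) apply_frame :: "nat \<Rightarrow> nat" where
  "apply_frame e \<equiv> pair 0 e"

abbreviation (input) list_frame :: "nat \<Rightarrow> nat \<Rightarrow> nat" where
  "list_frame es l \<equiv> pair 1 (pair es l)"

abbreviation (input) cons_frame :: "nat \<Rightarrow> nat" where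
  "cons_frame v \<equiv> pair 2 v"

abbreviation (input) rec_frame :: "nat \<Rightarrow> nat \<Rightarrow> nat" where
  "rec_frame e l \<equiv> pair 3 (pair e l)"

abbreviation (input) search_frame :: "nat \<Rightarrow> nat \<Rightarrow> nat \<Rightarrow> nat" where
  "search_frame e u l \<equiv> pair 4 (pair (pair e u) l)"

definition step_run :: "(nat \<Rightarrow> bool) \<Rightarrow> nat \<Rightarrow> nat \<Rightarrow> nat \<Rightarrow> nat \<Rightarrow> nat" where
  "step_run X t c l K =
    (if t = 0 then ret 0 K
     else if t = 1 then ret (Suc (hd_code l)) K
     else if t = 2 then
       (if c = 0 then ret (hd_code l) K else run (pair 2 (c - 1)) (tl_code l) K)
     else if t = 3 then run_list (psnd c) l (cons (apply_frame (pfst c)) K)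
     else if t = 4 then
       (if hd_code l = 0 then run (pfst c) (tl_code l) K
        else run (pair 4 c) (cons (hd_code l - 1) (tl_code l))
          (cons (rec_frame (psnd c) (cons (hd_code l - 1) (tl_code l))) K))
     else if t = 5 then search c 0 l K
     else ret (of_bool (X (hd_code l))) K)"

definition step_ret :: "nat \<Rightarrow> nat \<Rightarrow> nat \<Rightarrow> nat \<Rightarrow> nat" where
  "step_ret v t c K =
    (if t = 0 then run c v K
     else if t = 1 then run_list (pfst c) (psnd c) (cons (cons_frame v) K)
     else if t = 2 then ret (cons c v) K
     else if t = 3 then run (pfst c) (cons v (psnd c)) K
     else if v = 0 then ret (psnd (pfst c)) K
     else search (pfst (pfst c)) (Suc (psnd (pfst c))) (psnd c) K)"

definition step_conf :: "(nat \<Rightarrow> bool) \<Rightarrow> nat \<Rightarrow> nat \<Rightarrow> nat \<Rightarrow> nat \<Rightarrow> nat" where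
  "step_conf X t a b K =
    (if t = 0 then step_run X (pfst a) (psnd a) b K
     else if t = 1 then
       (if a = 0 then ret 0 K else run (hd_code a) b (cons (list_frame (tl_code a) b) K))
     else if t = 2 then
       run (pfst a) (cons (psnd a) b) (cons (search_frame (pfst a) (psnd a) b) K)
     else if K = 0 then conf t a b K
     else step_ret a (pfst (hd_code K)) (psnd (hd_code K)) (tl_code K))"

definition step :: "(nat \<Rightarrow> bool) \<Rightarrow> nat \<Rightarrow> nat" where
  "step X s = step_conf X (pfst s) (pfst (psnd s)) (pfst (psnd (psnd s))) (psnd (psnd (psnd s)))"

lemma step_conf_eq: "step X (conf t a b K) = step_conf X t a b K"
  by (simp add: step_def conf_def)

lemma
  shows step_run_Z: "step X (run (code Z) l K) = ret 0 K"
    and step_run_S: "step X (run (code S) (cons a l) K) = ret (Suc a) K"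
    and step_run_Id_0: "step X (run (code (Id 0)) (cons a l) K) = ret a K"
    and step_run_Id_Suc: "step X (run (code (Id (Suc i))) (cons a l) K) = run (code (Id i)) l K"
    and step_run_Comp: "step X (run (code (Comp f gs)) l K) =
      run_list (list_encode (map code gs)) l (cons (apply_frame (code f)) K)"
    and step_run_Pr_0: "step X (run (code (Pr f g)) (cons 0 l) K) = run (code f) l K"
    and step_run_Pr_Suc: "step X (run (code (Pr f g)) (cons (Suc n) l) K) =
      run (code (Pr f g)) (cons n l) (cons (rec_frame (code g) (cons n l)) K)"
    and step_run_Mn: "step X (run (code (Mn f)) l K) = search (code f) 0 l K"
    and step_run_Orc: "step X (run (code Orc) (cons a l) K) = ret (of_bool (X a)) K"
  by (simp_all add: step_conf_eq step_conf_def step_run_def)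

lemma
  shows step_run_list_Nil: "step X (run_list 0 l K) = ret 0 K"
    and step_run_list_Cons: "step X (run_list (cons e es) l K) = run e l (cons (list_frame es l) K)"
  by (simp_all add: step_conf_eq step_conf_def)

lemma step_search: "step X (search e u l K) = run e (cons u l) (cons (search_frame e u l) K)"
  by (simp add: step_conf_eq step_conf_def)

lemma
  shows step_ret_empty: "step X (ret v 0) = ret v 0"
    and step_ret_apply: "step X (ret v (cons (apply_frame e) K)) = run e v K"
    and step_ret_list: "step X (ret v (cons (list_frame es l) K)) =
      run_list es l (cons (cons_frame v) K)"
    and step_ret_cons: "step X (ret l (cons (cons_frame v) K)) = ret (cons v l) K"
    and step_ret_rec: "step X (ret v (cons (rec_frame e l) K)) = run e (cons v l) K"
    and step_ret_search_0: "step X (ret 0 (cons (search_frame e u l) K)) = ret u K"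
    and step_ret_search_Suc: "step X (ret (Suc v) (cons (search_frame e u l) K)) =
      search e (Suc u) l K"
  by (simp_all add: step_conf_eq step_conf_def step_ret_def)

definition reaches :: "(nat \<Rightarrow> bool) \<Rightarrow> nat \<Rightarrow> nat \<Rightarrow> bool" where
  "reaches X s s' \<longleftrightarrow> (\<exists>k. (step X ^^ k) s = s')"

lemma reaches_refl: "reaches X s s"
  unfolding reaches_def by (rule exI[of _ 0]) simp

lemma reaches_trans: "reaches X s s' \<Longrightarrow> reaches X s' s'' \<Longrightarrow> reaches X s s''"
  unfolding reaches_def by (metis funpow_add o_apply)

lemma reaches_step: "step X s = s' \<Longrightarrow> reaches X s' s'' \<Longrightarrow> reaches X s s''"
  unfolding reaches_def by (metis funpow_Suc_right o_apply)

lemma reaches_halting_unique: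
  assumes "reaches X s t" "reaches X s u" and "step X t = t" "step X u = u"
  shows "t = u"
proof -
  obtain k l where k: "(step X ^^ k) s = t" and l: "(step X ^^ l) s = u"
    using assms(1,2) unfolding reaches_def by blast
  have halt: "(step X ^^ n) v = v" if "step X v = v" for n v
    using that by (induction n) simp_all
  have "(step X ^^ (l + k)) s = t" using k halt[OF assms(3)] by (simp add: funpow_add)
  moreover have "(step X ^^ (k + l)) s = u" using l halt[OF assms(4)] by (simp add: funpow_add)
  ultimately show ?thesis by (simp add: add.commute)
qed

definition evaluates :: "(nat \<Rightarrow> bool) \<Rightarrow> nat \<Rightarrow> nat \<Rightarrow> nat \<Rightarrow> bool" where
  "evaluates X e l v \<longleftrightarrow> (\<forall>K. reaches X (run e l K) (ret v K))"

lemma evaluatesD: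
  "evaluates X e l v \<Longrightarrow> reaches X (ret v K) s \<Longrightarrow> reaches X (run e l K) s"
  unfolding evaluates_def using reaches_trans by blast

lemma reaches_run_list:
  assumes "list_all2 (\<lambda>g y. evaluates X (code g) l y) gs ys"
  shows "reaches X (run_list (list_encode (map code gs)) l K) (ret (list_encode ys) K)"
  using assms
proof (induction gs ys arbitrary: K rule: list_all2_induct)
  case Nil
  show ?case
    unfolding list.map list_encode.simps by (rule reaches_step[OF step_run_list_Nil reaches_refl])
next
  case (Cons g gs y ys)
  let ?gs = "list_encode (map code gs)"
  have "reaches X (ret (list_encode ys) (cons (cons_frame y) K)) (ret (list_encode (y # ys)) K)"
    by (rule reaches_step[OF step_ret_cons]) (simp add: reaches_refl)
  with Cons.IH have "reaches X (run_list ?gs l (cons (cons_frame y) K))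
      (ret (list_encode (y # ys)) K)"
    by (rule reaches_trans)
  then have "reaches X (ret y (cons (list_frame ?gs l) K)) (ret (list_encode (y # ys)) K)"
    by (rule reaches_step[OF step_ret_list])
  with Cons.hyps(1) have "reaches X (run (code g) l (cons (list_frame ?gs l) K))
      (ret (list_encode (y # ys)) K)"
    by (rule evaluatesD)
  then show ?case
    unfolding list.map list_encode.simps by (rule reaches_step[OF step_run_list_Cons])
qed

lemma reaches_search:
  assumes "evaluates X e (cons v l) 0"
    and "\<And>u. u < v \<Longrightarrow> \<exists>r. evaluates X e (cons u l) (Suc r)"
    and "u \<le> v"
  shows "reaches X (search e u l K) (ret v K)"
  using assms(3)
proof (induction rule: inc_induct)
  case base
  have "reaches X (ret 0 (cons (search_frame e v l) K)) (ret v K)"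
    by (rule reaches_step[OF step_ret_search_0 reaches_refl])
  with assms(1) show ?case
    by (rule reaches_step[OF step_search evaluatesD])
next
  case (step u)
  obtain r where "evaluates X e (cons u l) (Suc r)"
    using assms(2)[OF step.hyps(2)] by blast
  moreover have "reaches X (ret (Suc r) (cons (search_frame e u l) K)) (ret v K)"
    using step.IH by (rule reaches_step[OF step_ret_search_Suc])
  ultimately show ?case
    by (rule reaches_step[OF step_search evaluatesD])
qed

lemma evaluates_if_step_ret:
  "(\<And>K. step X (run e l K) = ret v K) \<Longrightarrow> evaluates X e l v"
  unfolding evaluates_def by (blast intro: reaches_step reaches_refl)

lemma evaluates_if_step_run:
  "(\<And>K. step X (run e l K) = run e' l' K) \<Longrightarrow> evaluates X e' l' v \<Longrightarrow> evaluates X e l v"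
  unfolding evaluates_def by (blast intro: reaches_step)

lemma evaluates_Id:
  "i < length xs \<Longrightarrow> evaluates X (code (Id i)) (list_encode xs) (xs ! i)"
proof (induction xs arbitrary: i)
  case Nil
  then show ?case by simp
next
  case (Cons x xs)
  show ?case
  proof (cases i)
    case 0
    then show ?thesis
      by (simp only: list_encode.simps nth_Cons_0 evaluates_if_step_ret step_run_Id_0)
  next
    case (Suc j)
    then have "evaluates X (code (Id j)) (list_encode xs) ((x # xs) ! i)"
      using Cons by simp
    then show ?thesis
      unfolding list_encode.simps Suc by (rule evaluates_if_step_run[OF step_run_Id_Suc])
  qed
qed

lemma evaluates_Comp:
  assumes "list_all2 (\<lambda>g y. evaluates X (code g) l y) gs ys"
    and f: "evaluates X (code f) (list_encode ys) v"
  shows "evaluates X (code (Comp f gs)) l v"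
  unfolding evaluates_def
proof
  fix K
  let ?K = "cons (apply_frame (code f)) K"
  have "reaches X (run_list (list_encode (map code gs)) l ?K) (ret (list_encode ys) ?K)"
    using assms(1) by (rule reaches_run_list)
  moreover have "reaches X (ret (list_encode ys) ?K) (ret v K)"
    using f unfolding evaluates_def by (intro reaches_step[OF step_ret_apply]) blast
  ultimately show "reaches X (run (code (Comp f gs)) l K) (ret v K)"
    by (rule reaches_step[OF step_run_Comp reaches_trans])
qed

lemma evaluates_Pr_Suc:
  assumes rec: "evaluates X (code (Pr f g)) (cons n l) r"
    and g: "evaluates X (code g) (cons r (cons n l)) v"
  shows "evaluates X (code (Pr f g)) (cons (Suc n) l) v"
  unfolding evaluates_def
proof
  fix K
  have "reaches X (run (code g) (cons r (cons n l)) K) (ret v K)"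
    using g unfolding evaluates_def by blast
  then have "reaches X (ret r (cons (rec_frame (code g) (cons n l)) K)) (ret v K)"
    by (rule reaches_step[OF step_ret_rec])
  with rec have "reaches X (run (code (Pr f g)) (cons n l) (cons (rec_frame (code g) (cons n l)) K))
      (ret v K)"
    by (rule evaluatesD)
  then show "reaches X (run (code (Pr f g)) (cons (Suc n) l) K) (ret v K)"
    by (rule reaches_step[OF step_run_Pr_Suc])
qed

lemma evaluates_Mn:
  assumes "evaluates X (code f) (cons v l) 0"
    and "\<And>u. u < v \<Longrightarrow> \<exists>r. evaluates X (code f) (cons u l) (Suc r)"
  shows "evaluates X (code (Mn f)) l v"
  using reaches_search[OF assms] unfolding evaluates_def
  by (blast intro: reaches_step[OF step_run_Mn])

lemma oeval_imp_evaluates: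
  "oeval X p xs v \<Longrightarrow> evaluates X (code p) (list_encode xs) v"
proof (induction rule: oeval.induct)
  case (zero xs)
  show ?case by (rule evaluates_if_step_ret[OF step_run_Z])
next
  case (succ x xs)
  show ?case unfolding list_encode.simps by (rule evaluates_if_step_ret[OF step_run_S])
next
  case (proj i xs)
  then show ?case by (rule evaluates_Id)
next
  case (comp xs gs ys f v)
  have "list_all2 (\<lambda>g y. evaluates X (code g) (list_encode xs) y) gs ys"
    using comp(1) by (rule list_all2_mono) blast
  then show ?case using comp.IH(2) by (rule evaluates_Comp)
next
  case (pr0 f xs v g)
  show ?case
    using pr0.IH unfolding list_encode.simps by (rule evaluates_if_step_run[OF step_run_Pr_0])
next
  case (prS f g n xs r v)
  show ?case
    using prS.IH unfolding list_encode.simps by (rule evaluates_Pr_Suc)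
next
  case (mn f v xs)
  show ?case
  proof (rule evaluates_Mn)
    show "evaluates X (code f) (cons v (list_encode xs)) 0"
      using mn.IH(1) by simp
    show "\<exists>r. evaluates X (code f) (cons u (list_encode xs)) (Suc r)" if "u < v" for u
      using mn.IH(2) that by (metis list_encode.simps(2) not0_implies_Suc)
  qed
next
  case (orc n xs)
  show ?case
    unfolding list_encode.simps of_bool_def[symmetric]
    by (rule evaluates_if_step_ret[OF step_run_Orc])
qed

definition univ_eval :: "(nat \<Rightarrow> bool) \<Rightarrow> nat \<Rightarrow> nat \<Rightarrow> bool \<Rightarrow> bool" where
  "univ_eval X e i v \<longleftrightarrow> reaches X (run e (cons i 0) 0) (ret (of_bool v) 0)"

lemma univ_eval_unique:
  assumes "univ_eval X e i v" "univ_eval X e i w"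
  shows "v = w"
proof -
  have "ret (of_bool v) 0 = ret (of_bool w) 0"
    using assms unfolding univ_eval_def by (rule reaches_halting_unique) (rule step_ret_empty)+
  then show ?thesis by (simp add: conf_def of_bool_eq_iff)
qed

definition index_upto :: "(nat \<Rightarrow> bool) \<Rightarrow> nat \<Rightarrow> (nat \<Rightarrow> bool) \<Rightarrow> nat \<Rightarrow> bool" where
  "index_upto X e b n \<longleftrightarrow> (\<forall>i<n. univ_eval X e i (b i))"

definition index_of :: "(nat \<Rightarrow> bool) \<Rightarrow> nat \<Rightarrow> (nat \<Rightarrow> bool) \<Rightarrow> bool" where
  "index_of X e b \<longleftrightarrow> (\<forall>i. univ_eval X e i (b i))"

lemma ex_index_of:
  assumes "turing_le b X"
  obtains e where "index_of X e b"
proof -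
  obtain p where p: "\<And>n. oeval X p [n] (of_bool (b n))"
    using assms by (auto simp: turing_le_def of_bool_def)
  have "univ_eval X (code p) i (b i)" for i
    using oeval_imp_evaluates[OF p] by (simp add: univ_eval_def evaluates_def)
  then show ?thesis using that unfolding index_of_def by blast
qed

lemma univ_eval_iff: "index_of X e b \<Longrightarrow> univ_eval X e i v \<longleftrightarrow> v = b i"
  unfolding index_of_def using univ_eval_unique by blast

lemma ex_index_upto_imp_index_of:
  "\<exists>L. \<forall>e\<le>n. index_upto X e b L \<longrightarrow> index_of X e b"
proof -
  have "\<exists>i. \<not> index_of X e b \<longrightarrow> \<not> univ_eval X e i (b i)" for e
    unfolding index_of_def by blast
  then obtain w where w: "\<And>e. \<not> index_of X e b \<Longrightarrow> \<not> univ_eval X e (w e) (b (w e))"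
    by metis
  have "w e < Suc (\<Sum>e\<le>n. w e)" if "e \<le> n" for e
    using member_le_sum[of e "{..n}" w] that by (simp add: le_imp_less_Suc)
  then show ?thesis unfolding index_upto_def using w by blast
qed

lemma computable_step:
  assumes "turing_le X Y" "computable_in Y f"
  shows "computable_in Y (\<lambda>n. step X (f n))"
  unfolding step_def step_conf_def step_run_def step_ret_def conf_def
  by (intro computable_if computable_pair computable_pfst computable_psnd computable_Suc
      computable_pred computable_of_bool decidable_compose[OF assms(1)] decidable_eq assms(2)
      computable_const)

lemma semidecidable_univ_eval:
  assumes "turing_le X Y" "computable_in Y e" "computable_in Y i" "decidable_in Y v"
  shows "semidecidable_in Y (\<lambda>n. univ_eval X (e n) (i n) (v n))"
  unfolding univ_eval_def reaches_def conf_def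
  by (intro semidecidable_ex decidable_imp_semidecidable decidable_eq computable_funpow
      computable_step[OF assms(1)] computable_pair computable_Suc computable_const
      computable_compose[OF assms(2)] computable_compose[OF assms(3)] computable_of_bool
      decidable_compose[OF assms(4)] computable_pfst computable_psnd computable_id)

lemma turing_le_trans:
  assumes "turing_le b X" "turing_le X Y"
  shows "turing_le b Y"
proof -
  obtain e where e: "index_of X e b" using assms(1) by (rule ex_index_of)
  have "of_bool (b n) = m \<longleftrightarrow> m \<le> 1 \<and> univ_eval X e n (m = 1)" for n and m :: nat
    unfolding univ_eval_iff[OF e] by (cases "b n") auto
  moreover have "semidecidable_in Y (\<lambda>m. psnd m \<le> 1 \<and> univ_eval X e (pfst m) (psnd m = 1))"
    by (intro semidecidable_conj decidable_imp_semidecidable decidable_le semidecidable_univ_eval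
        assms(2) decidable_eq computable_pfst computable_psnd computable_id computable_const)
  ultimately show ?thesis
    unfolding decidable_iff_computable by (intro computable_if_semidecidable_graph) simp
qed

subsection \<open>Cantor space\<close>

definition first_diff :: "(nat \<Rightarrow> bool) \<Rightarrow> (nat \<Rightarrow> bool) \<Rightarrow> nat" where
  "first_diff a b = (LEAST i. a i \<noteq> b i)"

lemma first_diff_neq: "a \<noteq> b \<Longrightarrow> a (first_diff a b) \<noteq> b (first_diff a b)"
  unfolding first_diff_def by (rule LeastI_ex) blast

lemma agree_upto_first_diff: "agree_upto (first_diff a b) a b"
  unfolding first_diff_def agree_upto_def using not_less_Least by blast

lemma le_first_diff: "a \<noteq> b \<Longrightarrow> agree_upto n a b \<Longrightarrow> n \<le> first_diff a b"
  using first_diff_neq unfolding agree_upto_def by (metis not_le)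

lemma first_diff_eqI: "agree_upto n a b \<Longrightarrow> a n \<noteq> b n \<Longrightarrow> first_diff a b = n"
  unfolding first_diff_def agree_upto_def by (rule Least_equality) (auto simp: not_less[symmetric])

lemma agree_upto_mono: "agree_upto n a b \<Longrightarrow> m \<le> n \<Longrightarrow> agree_upto m a b"
  by (simp add: agree_upto_def)

lemma agree_upto_trans: "agree_upto n a b \<Longrightarrow> agree_upto n b c \<Longrightarrow> agree_upto n a c"
  by (simp add: agree_upto_def)

lemma cantor_closed_limit:
  assumes "cantor_closed C" and C: "\<And>k. s k \<in> C" and mono: "strict_mono D"
    and agree: "\<And>k. agree_upto (D k) (s k) (s (Suc k))"
  obtains c where "c \<in> C" "\<And>k. agree_upto (D k) (s k) c"
proof -
  have later: "agree_upto (D k) (s k) (s j)" if "k \<le> j" for k j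
    using that
  proof (induction rule: dec_induct)
    case base
    show ?case by (simp add: agree_upto_def)
  next
    case (step j)
    have "agree_upto (D k) (s j) (s (Suc j))"
      using agree agree_upto_mono mono step.hyps(1) by (metis strict_mono_less_eq)
    with step.IH show ?case by (rule agree_upto_trans)
  qed
  have stable: "s k i = s j i" if "i < D k" "i < D j" for i j k
    using later that unfolding agree_upto_def by (metis nle_le)
  have depth: "i < D (Suc i)" for i
    using strict_mono_imp_increasing[OF mono, of "Suc i"] by simp
  define c where "c i = s (Suc i) i" for i
  have lim: "agree_upto (D k) (s k) c" for k
    unfolding agree_upto_def c_def using stable depth by blast
  have "agree_upto n c (s n)" for n
    using lim[of n] strict_mono_imp_increasing[OF mono, of n] by (simp add: agree_upto_def)
  then have "c \<in> C" using assms(1) C unfolding cantor_closed_def by blast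
  then show ?thesis using lim that by blast
qed

definition crowded :: "(nat \<Rightarrow> bool) set \<Rightarrow> bool" where
  "crowded D \<longleftrightarrow> (\<forall>b\<in>D. \<forall>n. \<exists>b'\<in>D. b' \<noteq> b \<and> agree_upto n b b')"

lemma perfect_set_iff: "perfect_set C \<longleftrightarrow> C \<noteq> {} \<and> cantor_closed C \<and> crowded C"
  by (simp add: perfect_set_def crowded_def)

lemma crowded_first_diff:
  assumes "crowded D" "b \<in> D"
  obtains b' where "b' \<in> D" "b' \<noteq> b" "n \<le> first_diff b b'"
  using assms le_first_diff unfolding crowded_def by metis

lemma crowded_dense_in:
  assumes "crowded C" "dense_in B C"
  shows "crowded B"
  unfolding crowded_def
proof (intro ballI allI)
  fix b n assume "b \<in> B"
  then have "b \<in> C" using assms(2) by (auto simp: dense_in_def)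
  then obtain a where a: "a \<in> C" "a \<noteq> b" "agree_upto n b a"
    using assms(1) unfolding crowded_def by blast
  obtain b' where b': "b' \<in> B" "agree_upto (max n (Suc (first_diff a b))) a b'"
    using assms(2) a(1) unfolding dense_in_def by blast
  have "b' (first_diff a b) \<noteq> b (first_diff a b)"
    using b'(2) first_diff_neq[OF a(2)] by (auto simp: agree_upto_def)
  moreover have "agree_upto n b b'"
    using a(3) b'(2) by (simp add: agree_upto_def)
  ultimately show "\<exists>b'\<in>B. b' \<noteq> b \<and> agree_upto n b b'" using b'(1) by metis
qed

lemma crowded_cylinder:
  assumes "crowded D"
  shows "crowded {b \<in> D. agree_upto n a b}"
  unfolding crowded_def
proof (intro ballI allI)
  fix b m assume b: "b \<in> {b \<in> D. agree_upto n a b}"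
  then obtain b' where b': "b' \<in> D" "b' \<noteq> b" "agree_upto (max m n) b b'"
    using assms unfolding crowded_def by blast
  have "agree_upto n a b'" "agree_upto m b b'"
    using b b'(3) by (simp_all add: agree_upto_def)
  then show "\<exists>b'\<in>{b \<in> D. agree_upto n a b}. b' \<noteq> b \<and> agree_upto m b b'"
    using b'(1,2) by blast
qed

lemma cantor_closed_cylinder:
  assumes "cantor_closed C"
  shows "cantor_closed {b \<in> C. agree_upto n a b}"
  unfolding cantor_closed_def
proof (intro allI impI)
  fix z assume z: "\<forall>m. \<exists>b\<in>{b \<in> C. agree_upto n a b}. agree_upto m z b"
  then have "z \<in> C" using assms unfolding cantor_closed_def by blast
  moreover have "agree_upto n a z" using z[rule_format, of n] by (auto simp: agree_upto_def)
  ultimately show "z \<in> {b \<in> C. agree_upto n a b}" by simp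
qed

lemma crowded_avoid:
  assumes "crowded C" "a \<in> C"
  obtains b m where "b \<in> C" "agree_upto n a b" "n < m" "\<not> agree_upto m b z"
proof -
  obtain b where b: "b \<in> C" "agree_upto n a b" "b \<noteq> z"
  proof (cases "a = z")
    case True
    then show ?thesis using assms that unfolding crowded_def by metis
  next
    case False
    then show ?thesis using assms(2) that[of a] by (simp add: agree_upto_def)
  qed
  have "\<not> agree_upto (Suc (max n (first_diff b z))) b z"
    using first_diff_neq[OF b(3)] unfolding agree_upto_def by (meson le_imp_less_Suc max.cobounded2)
  then show ?thesis using b that[of b "Suc (max n (first_diff b z))"] by simp
qed

lemma uncountable_perfect_set:
  assumes "perfect_set C"
  shows "uncountable C"
proof
  assume "countable C"
  have C: "C \<noteq> {}" "cantor_closed C" "crowded C" using assms by (simp_all add: perfect_set_iff)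
  define f where "f = from_nat_into C"
  have "\<exists>\<sigma>. \<forall>k. fst (\<sigma> k) \<in> C \<and> (agree_upto (snd (\<sigma> k)) (fst (\<sigma> k)) (fst (\<sigma> (Suc k))) \<and>
      snd (\<sigma> k) < snd (\<sigma> (Suc k)) \<and> \<not> agree_upto (snd (\<sigma> (Suc k))) (fst (\<sigma> (Suc k))) (f k))"
  proof (rule dependent_nat_choice)
    show "\<exists>\<sigma> :: (nat \<Rightarrow> bool) \<times> nat. fst \<sigma> \<in> C" using C(1) by auto
  next
    fix \<sigma> :: "(nat \<Rightarrow> bool) \<times> nat" and k
    assume "fst \<sigma> \<in> C"
    with C(3) obtain b m where "b \<in> C" "agree_upto (snd \<sigma>) (fst \<sigma>) b" "snd \<sigma> < m"
        "\<not> agree_upto m b (f k)"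
      by (rule crowded_avoid)
    then show "\<exists>\<tau>. fst \<tau> \<in> C \<and> (agree_upto (snd \<sigma>) (fst \<sigma>) (fst \<tau>) \<and>
        snd \<sigma> < snd \<tau> \<and> \<not> agree_upto (snd \<tau>) (fst \<tau>) (f k))"
      by (intro exI[of _ "(b, m)"]) simp
  qed
  then obtain \<sigma> where \<sigma>: "\<And>k. fst (\<sigma> k) \<in> C"
      "\<And>k. agree_upto (snd (\<sigma> k)) (fst (\<sigma> k)) (fst (\<sigma> (Suc k)))"
      "\<And>k. snd (\<sigma> k) < snd (\<sigma> (Suc k))"
      "\<And>k. \<not> agree_upto (snd (\<sigma> (Suc k))) (fst (\<sigma> (Suc k))) (f k)"
    by blast
  have "strict_mono (\<lambda>k. snd (\<sigma> k))" using \<sigma>(3) by (simp add: strict_mono_Suc_iff)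
  with C(2) \<sigma>(1) obtain c where c: "c \<in> C" "\<And>k. agree_upto (snd (\<sigma> k)) (fst (\<sigma> k)) c"
    using \<sigma>(2) by (rule cantor_closed_limit) blast
  obtain k where "c = f k" using c(1) \<open>countable C\<close> from_nat_into_surj unfolding f_def by metis
  then show False using c(2)[of "Suc k"] \<sigma>(4)[of k] by simp
qed

subsection \<open>Coding\<close>

text \<open>Below, \<^term>\<open>p (t mod 3)\<close>, \<^term>\<open>p (t mod 3 + 3)\<close>, \<dots> are the successive targets of one of
  three reals, which leaves \<^term>\<open>p t\<close> for \<^term>\<open>p (t + 3)\<close> at position \<^term>\<open>switch p t\<close>.\<close>

definition switch :: "(nat \<Rightarrow> nat \<Rightarrow> bool) \<Rightarrow> nat \<Rightarrow> nat" where
  "switch p t = first_diff (p t) (p (t + 3))"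

text \<open>The last clause lets a decoder that knows \<^term>\<open>switch p s\<close> and \<^term>\<open>switch p (Suc s)\<close>
  recognize an index of \<^term>\<open>p (s + 2)\<close> by its values below the latter position; the first clause
  of stage \<^term>\<open>s\<close> bounds the search for it.\<close>

definition late_enough :: "(nat \<Rightarrow> bool) \<Rightarrow> (nat \<Rightarrow> nat \<Rightarrow> bool) \<Rightarrow> nat \<Rightarrow> nat \<Rightarrow> bool" where
  "late_enough X p t m \<longleftrightarrow> (\<exists>e\<le>m. index_of X e (p (t + 2))) \<and>
     (\<forall>s. t = Suc s \<longrightarrow> switch p s < m \<and>
       (\<forall>e\<le>switch p s. index_upto X e (p (t + 1)) m \<longrightarrow> index_of X e (p (t + 1))))"

definition admissible :: "(nat \<Rightarrow> bool) \<Rightarrow> (nat \<Rightarrow> nat \<Rightarrow> bool) \<Rightarrow> nat \<Rightarrow> (nat \<Rightarrow> bool) \<Rightarrow> bool" where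
  "admissible X p t a \<longleftrightarrow> a \<noteq> p t \<and> late_enough X p t (first_diff (p t) a)"

definition decodable :: "(nat \<Rightarrow> bool) \<Rightarrow> (nat \<Rightarrow> nat \<Rightarrow> bool) \<Rightarrow> bool" where
  "decodable X p \<longleftrightarrow> (\<forall>t. admissible X p t (p (t + 3)))"

lemma admissible_cong:
  assumes eq: "\<And>s. s < t + 3 \<Longrightarrow> p s = q s"
  shows "admissible X p t a \<longleftrightarrow> admissible X q t a"
proof -
  have "switch p s = switch q s" if "t = Suc s" for s
    using eq that by (simp add: switch_def)
  then have "late_enough X p t m \<longleftrightarrow> late_enough X q t m" for m
    using eq by (auto simp: late_enough_def)
  then show ?thesis using eq by (simp add: admissible_def)
qed

lemma ex_late_enough:
  assumes "turing_le (p (t + 2)) X"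
  shows "\<exists>n. \<forall>m\<ge>n. late_enough X p t m"
proof -
  obtain e where e: "index_of X e (p (t + 2))" using assms by (rule ex_index_of)
  show ?thesis
  proof (cases t)
    case 0
    then show ?thesis using e unfolding late_enough_def by blast
  next
    case (Suc s)
    obtain L where L: "\<forall>e\<le>switch p s. index_upto X e (p (t + 1)) L \<longrightarrow> index_of X e (p (t + 1))"
      using ex_index_upto_imp_index_of by blast
    have "late_enough X p t m" if m: "max (max e (Suc (switch p s))) L \<le> m" for m
    proof -
      have "index_upto X e' b L" if "index_upto X e' b m" for e' b
        using that m by (simp add: index_upto_def)
      then show ?thesis
        using e L m unfolding late_enough_def Suc by (auto intro!: exI[of _ e])
    qed
    then show ?thesis by blast
  qed
qed

lemma ex_first_diff_less_iff:
  assumes D: "crowded D" and "a \<in> D" "b \<in> D"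
  shows "\<exists>a'\<in>D. \<exists>b'\<in>D. a' \<noteq> a \<and> b' \<noteq> b \<and> m \<le> first_diff a a' \<and> n \<le> first_diff b b' \<and>
    (first_diff a a' < first_diff b b' \<longleftrightarrow> v)"
proof (cases v)
  case True
  obtain a' where "a' \<in> D" "a' \<noteq> a" "m \<le> first_diff a a'"
    using D \<open>a \<in> D\<close> by (rule crowded_first_diff)
  moreover obtain b' where "b' \<in> D" "b' \<noteq> b" "max n (Suc (first_diff a a')) \<le> first_diff b b'"
    using D \<open>b \<in> D\<close> by (rule crowded_first_diff)
  ultimately show ?thesis using True by (intro bexI[of _ a'] bexI[of _ b']) auto
next
  case False
  obtain b' where "b' \<in> D" "b' \<noteq> b" "n \<le> first_diff b b'"
    using D \<open>b \<in> D\<close> by (rule crowded_first_diff)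
  moreover obtain a' where "a' \<in> D" "a' \<noteq> a" "max m (first_diff b b') \<le> first_diff a a'"
    using D \<open>a \<in> D\<close> by (rule crowded_first_diff)
  ultimately show ?thesis using False by (intro bexI[of _ a'] bexI[of _ b']) auto
qed

lemma ex_admissible_pair:
  assumes "crowded D" "p t \<in> D" "q t \<in> D" "turing_le (p (t + 2)) X" "turing_le (q (t + 2)) X"
  shows "\<exists>a\<in>D. \<exists>b\<in>D. admissible X p t a \<and> admissible X q t b \<and>
    (first_diff (p t) a < first_diff (q t) b \<longleftrightarrow> v)"
proof -
  obtain m where "\<forall>k\<ge>m. late_enough X p t k" using ex_late_enough assms(4) by blast
  moreover obtain n where "\<forall>k\<ge>n. late_enough X q t k" using ex_late_enough assms(5) by blast
  ultimately show ?thesis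
    using ex_first_diff_less_iff[OF assms(1-3), of m n v] unfolding admissible_def by blast
qed

definition coding_step :: "(nat \<Rightarrow> bool) \<Rightarrow> (nat \<Rightarrow> bool) set \<Rightarrow> (nat \<Rightarrow> bool) \<Rightarrow>
    (nat \<Rightarrow> (nat \<Rightarrow> bool) \<times> (nat \<Rightarrow> bool)) \<Rightarrow> nat \<Rightarrow> (nat \<Rightarrow> bool) \<times> (nat \<Rightarrow> bool) \<Rightarrow> bool" where
  "coding_step X D y f t ab \<longleftrightarrow> ab \<in> D \<times> D \<and> (\<forall>s. t = s + 3 \<longrightarrow>
     admissible X (fst \<circ> f) s (fst ab) \<and> admissible X (snd \<circ> f) s (snd ab) \<and>
     (first_diff (fst (f s)) (fst ab) < first_diff (snd (f s)) (snd ab) \<longleftrightarrow> y s))"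

lemma coding_step_cong:
  assumes "\<And>s. s < t \<Longrightarrow> f s = g s"
  shows "coding_step X D y f t ab \<longleftrightarrow> coding_step X D y g t ab"
proof -
  have "admissible X (fst \<circ> f) s a \<longleftrightarrow> admissible X (fst \<circ> g) s a"
    "admissible X (snd \<circ> f) s a \<longleftrightarrow> admissible X (snd \<circ> g) s a"
    "f s = g s" if "t = s + 3" for s a
    using that assms by (auto intro!: admissible_cong)
  then show ?thesis unfolding coding_step_def by auto
qed

lemma ex_coding_step:
  assumes "crowded D" "D \<noteq> {}" "\<And>b. b \<in> D \<Longrightarrow> turing_le b X"
    and f: "\<And>s. s < t \<Longrightarrow> f s \<in> D \<times> D"
  shows "\<exists>ab. coding_step X D y f t ab"
proof (cases "\<exists>s. t = s + 3")
  case True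
  then obtain s where s: "t = s + 3" by blast
  have "(fst \<circ> f) i \<in> D" "(snd \<circ> f) i \<in> D" if "i < t" for i
    using f[OF that] by (simp_all add: mem_Times_iff)
  then have "\<exists>a\<in>D. \<exists>b\<in>D. admissible X (fst \<circ> f) s a \<and> admissible X (snd \<circ> f) s b \<and>
      (first_diff ((fst \<circ> f) s) a < first_diff ((snd \<circ> f) s) b \<longleftrightarrow> y s)"
    using s assms(3) by (intro ex_admissible_pair assms(1)) simp_all
  then obtain a b where "coding_step X D y f t (a, b)" unfolding coding_step_def s by auto
  then show ?thesis by blast
next
  case False
  then show ?thesis using assms(2) unfolding coding_step_def by auto
qed

lemma ex_decodable_pair:
  assumes "crowded D" "D \<noteq> {}" "\<And>b. b \<in> D \<Longrightarrow> turing_le b X"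
  obtains p q where "range p \<subseteq> D" "range q \<subseteq> D" "decodable X p" "decodable X q"
    "\<And>t. switch p t < switch q t \<longleftrightarrow> y t"
proof -
  have "\<exists>f. \<forall>t. coding_step X D y f t (f t)"
  proof (rule dependent_wellorder_choice)
    show "coding_step X D y f t ab = coding_step X D y g t ab" if "\<And>s. s < t \<Longrightarrow> f s = g s"
      for ab f g t
      using that by (rule coding_step_cong)
    show "\<exists>ab. coding_step X D y f t ab" if "\<And>s. s < t \<Longrightarrow> coding_step X D y f s (f s)" for t f
      using that by (intro ex_coding_step assms) (auto simp: coding_step_def)
  qed
  then obtain f where f: "\<And>t. coding_step X D y f t (f t)" by blast
  show thesis
  proof (rule that)
    show "range (fst \<circ> f) \<subseteq> D" "range (snd \<circ> f) \<subseteq> D"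
      using f by (auto simp: coding_step_def mem_Times_iff)
    show "decodable X (fst \<circ> f)" "decodable X (snd \<circ> f)"
      "switch (fst \<circ> f) t < switch (snd \<circ> f) t \<longleftrightarrow> y t" for t
      using f[of "t + 3" for t] by (auto simp: coding_step_def decodable_def switch_def)
  qed
qed

lemma decodable_neq: "decodable X p \<Longrightarrow> p t \<noteq> p (t + 3)"
  unfolding decodable_def admissible_def by metis

lemma decodable_late_enough: "decodable X p \<Longrightarrow> late_enough X p t (switch p t)"
  by (simp add: decodable_def admissible_def switch_def)

lemma decodable_strict_mono:
  assumes "decodable X p"
  shows "strict_mono (switch p)"
  unfolding strict_mono_Suc_iff
  using decodable_late_enough[OF assms] by (auto simp: late_enough_def)

lemma decodable_ex_index:
  "decodable X p \<Longrightarrow> \<exists>e\<le>switch p t. index_of X e (p (t + 2))"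
  using decodable_late_enough unfolding late_enough_def by blast

lemma decodable_index_upto:
  assumes "decodable X p" "e \<le> switch p t" "index_upto X e (p (t + 2)) (switch p (t + 1))"
  shows "index_of X e (p (t + 2))"
  using decodable_late_enough[OF assms(1), of "Suc t"] assms(2,3) by (simp add: late_enough_def)

definition limit_triple :: "(nat \<Rightarrow> nat \<Rightarrow> bool) \<Rightarrow> (nat \<Rightarrow> bool) list \<Rightarrow> bool" where
  "limit_triple p cs \<longleftrightarrow> length cs = 3 \<and>
     (\<forall>t. p t \<noteq> cs ! (t mod 3) \<and> first_diff (p t) (cs ! (t mod 3)) = switch p t)"

lemma ex_limit_triple:
  assumes p: "decodable X p" and "cantor_closed C" "range p \<subseteq> C"
  obtains cs where "limit_triple p cs" "set cs \<subseteq> C"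
proof -
  have mono: "strict_mono (switch p)" using p by (rule decodable_strict_mono)
  have "\<exists>c\<in>C. \<forall>k. agree_upto (switch p (r + 3 * k)) (p (r + 3 * k)) c" for r
  proof (rule cantor_closed_limit[OF assms(2)])
    show "p (r + 3 * k) \<in> C" for k using assms(3) by blast
    show "strict_mono (\<lambda>k. switch p (r + 3 * k))"
      using mono by (simp add: strict_mono_def)
    show "agree_upto (switch p (r + 3 * k)) (p (r + 3 * k)) (p (r + 3 * Suc k))" for k
      using agree_upto_first_diff[of "p (r + 3 * k)" "p (r + 3 * k + 3)"]
      by (simp add: switch_def add_ac)
  qed blast
  then obtain c where c: "\<And>r. c r \<in> C"
      "\<And>r k. agree_upto (switch p (r + 3 * k)) (p (r + 3 * k)) (c r)"
    by metis
  have agree: "agree_upto (switch p t) (p t) (c (t mod 3))" for t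
    using c(2)[of "t mod 3" "t div 3"] by simp
  have neq: "p t (switch p t) \<noteq> c (t mod 3) (switch p t)" for t
  proof -
    have "switch p t < switch p (t + 3)" using mono by (simp add: strict_mono_less)
    then have "c (t mod 3) (switch p t) = p (t + 3) (switch p t)"
      using agree[of "t + 3"] by (simp add: agree_upto_def)
    then show ?thesis
      using first_diff_neq[OF decodable_neq[OF p]] by (simp add: switch_def)
  qed
  show thesis
  proof (rule that)
    have "map c [0..<3] ! (t mod 3) = c (t mod 3)" for t by simp
    then show "limit_triple p (map c [0..<3])"
      using neq first_diff_eqI[OF agree neq] unfolding limit_triple_def
      by (metis length_map length_upt diff_zero)
    show "set (map c [0..<3]) \<subseteq> C" using c(1) by auto
  qed
qed

definition departs_at :: "(nat \<Rightarrow> bool) \<Rightarrow> nat \<Rightarrow> (nat \<Rightarrow> bool) \<Rightarrow> nat \<Rightarrow> bool" where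
  "departs_at X e c z \<longleftrightarrow> index_upto X e c z \<and> univ_eval X e z (\<not> c z)"

lemma departs_at_iff:
  assumes "index_of X e b"
  shows "departs_at X e c z \<longleftrightarrow> b \<noteq> c \<and> first_diff b c = z"
proof
  assume "departs_at X e c z"
  then have "agree_upto z b c" "b z \<noteq> c z"
    by (auto simp: departs_at_def index_upto_def univ_eval_iff[OF assms] agree_upto_def)
  then show "b \<noteq> c \<and> first_diff b c = z" using first_diff_eqI by blast
next
  assume "b \<noteq> c \<and> first_diff b c = z"
  then have "agree_upto z b c" "b z \<noteq> c z" using first_diff_neq agree_upto_first_diff by blast+
  then show "departs_at X e c z"
    by (auto simp: departs_at_def index_upto_def univ_eval_iff[OF assms] agree_upto_def)
qed

lemma switch_eq_iff:
  assumes p: "decodable X p" and cs: "limit_triple p cs"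
  shows "z = switch p (t + 2) \<longleftrightarrow>
    switch p (t + 1) < z \<and> (\<exists>e\<le>switch p t. departs_at X e (cs ! ((t + 2) mod 3)) z)"
    (is "_ \<longleftrightarrow> _ \<and> (\<exists>e\<le>_. departs_at X e ?c z)")
proof
  assume z: "z = switch p (t + 2)"
  have "switch p (t + 1) < switch p (t + 2)"
    using decodable_strict_mono[OF p] by (simp add: strict_mono_less)
  moreover obtain e where e: "e \<le> switch p t" "index_of X e (p (t + 2))"
    using decodable_ex_index[OF p] by blast
  moreover have "departs_at X e ?c z"
    using cs z unfolding departs_at_iff[OF e(2)] limit_triple_def by blast
  ultimately show "switch p (t + 1) < z \<and> (\<exists>e\<le>switch p t. departs_at X e ?c z)"
    using z by blast
next
  assume "switch p (t + 1) < z \<and> (\<exists>e\<le>switch p t. departs_at X e ?c z)"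
  then obtain e where e: "switch p (t + 1) < z" "e \<le> switch p t" "departs_at X e ?c z" by blast
  have lim: "first_diff (p (t + 2)) ?c = switch p (t + 2)"
    using cs by (simp add: limit_triple_def)
  have "switch p (t + 1) \<le> switch p (t + 2)"
    using decodable_strict_mono[OF p] by (simp add: strict_mono_less_eq)
  then have "agree_upto (switch p (t + 1)) (p (t + 2)) ?c"
    using lim agree_upto_first_diff agree_upto_mono by metis
  then have "index_upto X e (p (t + 2)) (switch p (t + 1))"
    using e(1,3) by (simp add: departs_at_def index_upto_def agree_upto_def)
  with p e(2) have "index_of X e (p (t + 2))" by (rule decodable_index_upto)
  then show "z = switch p (t + 2)" using e(3) lim by (simp add: departs_at_iff)
qed

lemma computable_switch:
  assumes p: "decodable X p" and cs: "limit_triple p cs"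
    and X: "turing_le X Y" and Y: "turing_le (join cs) Y"
  shows "computable_in Y (switch p)"
proof (rule computable_course_of_values)
  let ?c = "\<lambda>t i. join cs (3 * i + t mod 3)"
  let ?G = "\<lambda>t h z. t < 2 \<and> z = (if t = 0 then switch p 0 else switch p 1) \<or>
      2 \<le> t \<and> entry h (t - 1) < z \<and> (\<exists>e. e < Suc (entry h (t - 2)) \<and> departs_at X e (?c t) z)"
  show "semidecidable_in Y (\<lambda>m. ?G (pfst (pfst m)) (psnd (pfst m)) (psnd m))"
    unfolding departs_at_def index_upto_def
    by (intro semidecidable_disj semidecidable_conj semidecidable_ex semidecidable_ball
        semidecidable_univ_eval[OF X] decidable_imp_semidecidable[OF decidable_less]
        decidable_imp_semidecidable[OF decidable_le] decidable_imp_semidecidable[OF decidable_eq]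
        decidable_not decidable_compose[OF Y] decidable_eq computable_if computable_add
        computable_diff computable_mult computable_mod computable_Suc computable_entry
        computable_pfst computable_psnd computable_id computable_const)
  fix t h z assume h: "\<And>s. s < t \<Longrightarrow> entry h s = switch p s"
  consider "t < 2" | s where "t = s + 2" by (metis le_add_diff_inverse2 not_less)
  then show "?G t h z \<longleftrightarrow> z = switch p t"
  proof cases
    case 1
    then show ?thesis by (auto simp: less_2_cases_iff)
  next
    case 2
    have "?c t = cs ! (t mod 3)"
      using cs join_index[of "t mod 3" cs] by (simp add: limit_triple_def fun_eq_iff)
    then show ?thesis
      using switch_eq_iff[OF p cs, of z s] h[of s] h[of "s + 1"] 2 by (auto simp: less_Suc_eq_le)
  qed
qed

lemma ex_turing_le_join_closed:
  assumes "cantor_closed C" "D \<subseteq> C" "D \<noteq> {}" "crowded D" and D: "\<And>b. b \<in> D \<Longrightarrow> turing_le b X"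
  obtains cs where "set cs \<subseteq> C" "turing_le y (join (X # cs))"
proof -
  obtain p q where pq: "range p \<subseteq> D" "range q \<subseteq> D" "decodable X p" "decodable X q"
    and y: "\<And>t. switch p t < switch q t \<longleftrightarrow> y t"
    using ex_decodable_pair[OF assms(4,3) D, of y] by blast
  obtain cs where cs: "limit_triple p cs" "set cs \<subseteq> C"
    using ex_limit_triple[OF pq(3) assms(1)] pq(1) assms(2) by blast
  obtain cs' where cs': "limit_triple q cs'" "set cs' \<subseteq> C"
    using ex_limit_triple[OF pq(4) assms(1)] pq(2) assms(2) by blast
  let ?Y = "join (X # cs @ cs')"
  have "cs \<noteq> []" "cs' \<noteq> []" using cs(1) cs'(1) by (auto simp: limit_triple_def)
  then have "turing_le (join cs) ?Y" "turing_le (join cs') ?Y"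
    by (simp_all add: join_turing_le turing_le_join)
  moreover have "turing_le X ?Y" by (intro turing_le_join) simp
  ultimately have "computable_in ?Y (switch p)" "computable_in ?Y (switch q)"
    using computable_switch pq(3,4) cs(1) cs'(1) by blast+
  then have "turing_le y ?Y" unfolding y[symmetric, abs_def] by (rule decidable_less)
  then show thesis using cs(2) cs'(2) by (intro that[of "cs @ cs'"]) auto
qed

lemma ex_turing_le_join_perfect:
  assumes "perfect_set C" "dense_in B C" "\<And>b. b \<in> B \<Longrightarrow> turing_le b x" "y \<notin> B"
  obtains cs where "set cs \<subseteq> C - {y}" "turing_le y (join (x # cs))"
proof -
  have C: "C \<noteq> {}" "cantor_closed C" "crowded C" using assms(1) by (simp_all add: perfect_set_iff)
  have B: "B \<subseteq> C" "B \<noteq> {}" using assms(2) C(1) by (auto simp: dense_in_def)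
  then obtain b where b: "b \<in> B" "b \<noteq> y" using assms(4) by blast
  \<comment> \<open>Coding inside a cylinder that misses \<^term>\<open>y\<close> keeps the coding reals different from \<^term>\<open>y\<close>.\<close>
  define n where "n = Suc (first_diff b y)"
  have y: "\<not> agree_upto n b y" using first_diff_neq[OF b(2)] by (auto simp: n_def agree_upto_def)
  obtain cs where cs: "set cs \<subseteq> {a \<in> C. agree_upto n b a}" "turing_le y (join (x # cs))"
  proof (rule ex_turing_le_join_closed)
    show "cantor_closed {a \<in> C. agree_upto n b a}"
      using C(2) by (rule cantor_closed_cylinder)
    show "crowded {a \<in> B. agree_upto n b a}"
      using crowded_dense_in[OF C(3) assms(2)] by (rule crowded_cylinder)
    show "{a \<in> B. agree_upto n b a} \<noteq> {}"
      using b(1) by (auto simp: agree_upto_def)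
  qed (use B(1) assms(3) in auto)
  then show thesis using that y by blast
qed

lemma join_turing_le_join_filter:
  assumes "\<forall>b\<in>B. turing_le b x"
  shows "turing_le (join (x # as)) (join (x # filter (\<lambda>a. a \<notin> B) as))" (is "turing_le _ ?Y")
proof (rule join_turing_le)
  show "\<forall>a\<in>set (x # as). turing_le a ?Y"
  proof
    fix a assume a: "a \<in> set (x # as)"
    have "turing_le x ?Y" by (rule turing_le_join) simp
    moreover have "turing_le a ?Y" if "a \<notin> B" using that a by (intro turing_le_join) auto
    ultimately show "turing_le a ?Y" using assms turing_le_trans by blast
  qed
qed simp

theorem theorem1p3:
  fixes A A' B :: "(nat \<Rightarrow> bool) set" and x :: "nat \<Rightarrow> bool"
  assumes "turing_independent A"
    and "A' \<subseteq> A" and "perfect_set A'"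
    and "countable B" and "dense_in B A'"
    and "\<forall>b\<in>B. turing_le b x"
  shows "\<not> turing_independent ((A - B) \<union> {x})"
proof
  assume indep: "turing_independent ((A - B) \<union> {x})"
  have "uncountable (A' - insert x B)"
    using assms(3,4) by (intro uncountable_minus_countable uncountable_perfect_set) auto
  then have "A' - insert x B \<noteq> {}" by (metis countable_empty)
  then obtain y where y: "y \<in> A'" "y \<notin> B" "y \<noteq> x" by blast
  obtain cs where cs: "set cs \<subseteq> A' - {y}" "turing_le y (join (x # cs))"
    using ex_turing_le_join_perfect[OF assms(3,5)] assms(6) y(2) by blast
  \<comment> \<open>Coding reals that happen to lie in \<^term>\<open>B\<close> are computable from \<^term>\<open>x\<close> and can be omitted.\<close>
  let ?as = "x # filter (\<lambda>a. a \<notin> B) cs"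
  have "turing_le y (join ?as)"
    using cs(2) join_turing_le_join_filter[OF assms(6)] by (rule turing_le_trans)
  moreover have "set ?as \<subseteq> (A - B) \<union> {x}" "y \<in> (A - B) \<union> {x}" "y \<notin> set ?as"
    using cs(1) y assms(2) by auto
  ultimately show False using indep unfolding turing_independent_def by blast
qed

end
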